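(* Let $\{X_n,n\ge 1\}$ be a sequence of random variables. Suppose that $1\leq p<\infty$ and $\sum_{n=1}^{\infty}E[|X_n|^p]<\infty$. Then for every $\varepsilon>0$, $$\sum_{n=2}^{\infty}\frac{1}{(\ln n)^{1+\varepsilon}}E\left[\left|\frac{S_n}{n}\right|^p\right]<\infty .$$
   Context: All random variables are real-valued and defined on a common probability space $(\Omega,\mathcal{F},P)$; no independence is assumed. $E$ denotes expectation and $S_n=\sum_{k=1}^n X_k$ for $n\ge 1$. *)

theory Defs
  imports "HOL-Probability.Probability"
begin

end

theory Submission
  imports Defs
begin

text \<open>By Jensen, \<open>E \<bar>S\<^sub>n / n\<bar>\<^sup>p \<le> (1/n) \<Sum>\<^sub>k\<^sub>\<le>\<^sub>n E \<bar>X\<^sub>k\<bar>\<^sup>p \<le> A / n\<close>, where \<open>A\<close> is the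
  sum of all \<open>E \<bar>X\<^sub>k\<bar>\<^sup>p\<close>; so the series is at most \<open>A\<close> times a convergent Bertrand series.\<close>

text \<open>On the open half-line this is \<open>powr_convex\<close>. If one of the two points is 0,
  the inequality reduces to \<open>(u * z) powr p \<le> u * z powr p\<close>, which holds because
  \<open>u powr p \<le> u\<close> for \<open>0 < u < 1\<close> and \<open>p \<ge> 1\<close>.\<close>

lemma convex_on_powr_nonneg:
  fixes p :: real
  assumes "1 \<le> p"
  shows "convex_on {0..} (\<lambda>x. x powr p)"
proof (rule convex_onI)
  fix t x y :: real
  assume t: "0 < t" "t < 1" and xy: "x \<in> {0..}" "y \<in> {0..}"
  have scale: "(u * z) powr p \<le> u * z powr p" if "0 < u" "u < 1" "0 \<le> z" for u z :: real
    using that assms powr_mono'[of 1 p u] by (simp add: powr_mult mult_right_mono)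
  consider "x = 0" | "y = 0" | "0 < x" "0 < y"
    using xy by fastforce
  then show "((1 - t) *\<^sub>R x + t *\<^sub>R y) powr p \<le> (1 - t) * x powr p + t * y powr p"
  proof cases
    case 1
    then show ?thesis using scale[of t y] t xy by simp
  next
    case 2
    then show ?thesis using scale[of "1 - t" x] t xy by simp
  next
    case 3
    then show ?thesis
      using convex_onD[OF powr_convex[OF assms], of t x y] t by simp
  qed
qed simp

text \<open>The triangle inequality moves the absolute value inside the mean; Jensen with equal
  weights \<open>1 / real (card I)\<close> then moves the power inside. Some \<open>x i\<close> may
  vanish, so convexity is required on the closed half-line.\<close>

lemma abs_mean_powr_le:
  fixes x :: "'i \<Rightarrow> real" and p :: real
  assumes "1 \<le> p" "finite I" "I \<noteq> {}"
  shows "\<bar>(\<Sum>i\<in>I. x i) / real (card I)\<bar> powr p \<le> (\<Sum>i\<in>I. \<bar>x i\<bar> powr p) / real (card I)"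
proof -
  have "card I > 0"
    using assms by (simp add: card_gt_0_iff)
  have "\<bar>(\<Sum>i\<in>I. x i) / real (card I)\<bar> \<le> (\<Sum>i\<in>I. \<bar>x i\<bar>) / real (card I)"
    by (simp add: abs_divide divide_right_mono)
  then have "\<bar>(\<Sum>i\<in>I. x i) / real (card I)\<bar> powr p \<le> ((\<Sum>i\<in>I. \<bar>x i\<bar>) / real (card I)) powr p"
    using assms by (intro powr_mono2) auto
  also have "\<dots> = (\<Sum>i\<in>I. (1 / real (card I)) *\<^sub>R \<bar>x i\<bar>) powr p"
    by (simp add: sum_divide_distrib)
  also have "\<dots> \<le> (\<Sum>i\<in>I. (1 / real (card I)) * \<bar>x i\<bar> powr p)"
    using assms \<open>card I > 0\<close> by (intro convex_on_sum[OF _ _ convex_on_powr_nonneg]) auto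
  also have "\<dots> = (\<Sum>i\<in>I. \<bar>x i\<bar> powr p) / real (card I)"
    by (simp add: sum_divide_distrib)
  finally show ?thesis .
qed

text \<open>Cauchy condensation turns the series into one dominated by a constant times the sum of
  \<open>real n powr (- s)\<close>, which converges for \<open>s > 1\<close>.\<close>

lemma summable_bertrand:
  fixes s :: real
  assumes "1 < s"
  shows "summable (\<lambda>n. 1 / (real (n + 2) * ln (real (n + 2)) powr s))"
proof -
  \<comment> \<open>The argument is shifted by one, so the series in question is \<open>f\<close>
    from index 1 on. Since \<open>ln 1 = 0\<close> and division by zero gives 0,
    \<open>f 0 = 0\<close>; hence \<open>f\<close> decreases only from index 1, which is all that
    condensation asks for.\<close>
  define f :: "nat \<Rightarrow> real" where "f n = 1 / (real (n + 1) * ln (real (n + 1)) powr s)" for n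
  have "f (Suc m) \<le> f m" if "0 < m" for m
    unfolding f_def using that assms
    by (intro divide_left_mono mult_mono powr_mono2 mult_pos_pos) auto
  moreover have "0 \<le> f n" for n
    by (simp add: f_def)
  moreover have "summable (\<lambda>n. 2 ^ n * f (2 ^ n))"
  proof (rule summable_comparison_test')
    show "summable (\<lambda>n. real n powr (- s) * ln 2 powr (- s))"
      using assms by (intro summable_mult2) (simp add: summable_real_powr_iff)
    fix n :: nat
    \<comment> \<open>At \<open>n = 0\<close> the majorant is 0 while \<open>f 1\<close> is
      positive, so the comparison starts at 1.\<close>
    assume "1 \<le> n"
    \<comment> \<open>The weight \<open>2 ^ n\<close> cancels against the linear factor of the
      denominator up to a quotient below 1; only the logarithm, at least \<open>n * ln 2\<close>,
      remains.\<close>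
    have "2 ^ n * f (2 ^ n) = (2 ^ n / (2 ^ n + 1)) * (1 / ln (2 ^ n + 1) powr s)"
      by (simp add: f_def add.commute)
    also have "\<dots> \<le> 1 * (1 / (real n * ln 2) powr s)"
    proof (rule mult_mono)
      have "real n * ln 2 = ln (2 ^ n)"
        by (simp add: ln_realpow)
      also have "\<dots> \<le> ln (2 ^ n + 1)"
        by (subst ln_le_cancel_iff) (auto intro: add_pos_pos)
      finally have "real n * ln 2 \<le> ln (2 ^ n + 1)" .
      then have "(real n * ln 2) powr s \<le> ln (2 ^ n + 1) powr s"
        using assms by (intro powr_mono2) auto
      moreover have "0 < (real n * ln 2) powr s"
        using \<open>1 \<le> n\<close> by simp
      ultimately show "1 / ln (2 ^ n + 1) powr s \<le> 1 / (real n * ln 2) powr s"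
        by (intro frac_le) auto
    qed (auto simp: divide_le_eq add_pos_pos)
    also have "\<dots> = real n powr (- s) * ln 2 powr (- s)"
      by (simp add: powr_mult powr_minus_divide)
    finally show "norm (2 ^ n * f (2 ^ n)) \<le> real n powr (- s) * ln 2 powr (- s)"
      by (simp add: f_def)
  qed
  ultimately have "summable f"
    using condensation_test[of f] by blast
  then have "summable (\<lambda>n. f (Suc n))"
    by (simp only: summable_Suc_iff)
  then show ?thesis
    by (simp add: f_def add.commute)
qed

theorem proposition3p5:
  fixes M :: "'a measure" and X :: "nat \<Rightarrow> 'a \<Rightarrow> real" and p :: real
  assumes "prob_space M"
    and "\<And>n. n \<ge> 1 \<Longrightarrow> X n \<in> borel_measurable M"
    and "1 \<le> p"
    and "(\<Sum>n. \<integral>\<^sup>+\<omega>. ennreal (\<bar>X (n + 1) \<omega>\<bar> powr p) \<partial>M) < \<infinity>"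
  shows "\<forall>\<epsilon>::real. \<epsilon> > 0 \<longrightarrow>
    (\<Sum>n. ennreal (1 / ln (real (n + 2)) powr (1 + \<epsilon>)) *
       (\<integral>\<^sup>+\<omega>. ennreal (\<bar>(\<Sum>k=1..n + 2. X k \<omega>) / real (n + 2)\<bar> powr p) \<partial>M)) < \<infinity>"
proof (intro allI impI)
  fix \<epsilon> :: real
  assume "\<epsilon> > 0"
  define a where "a k = (\<integral>\<^sup>+\<omega>. ennreal (\<bar>X k \<omega>\<bar> powr p) \<partial>M)" for k
  define A where "A = (\<Sum>n. a (n + 1))"
  define b where "b n = 1 / (real (n + 2) * ln (real (n + 2)) powr (1 + \<epsilon>))" for n
  \<comment> \<open>The bound is stated in \<open>ennreal\<close>, so it needs no integrability;
    finiteness of \<open>A\<close> enters only at the end.\<close>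
  have mean: "(\<integral>\<^sup>+\<omega>. ennreal (\<bar>(\<Sum>k=1..N. X k \<omega>) / real N\<bar> powr p) \<partial>M) \<le> ennreal (1 / real N) * A"
    if "N \<ge> 1" for N
  proof -
    have meas: "X k \<in> borel_measurable M" if "k \<in> {1..N}" for k
      using that assms(2) by simp
    have "(\<integral>\<^sup>+\<omega>. ennreal (\<bar>(\<Sum>k=1..N. X k \<omega>) / real N\<bar> powr p) \<partial>M)
        \<le> (\<integral>\<^sup>+\<omega>. ennreal (1 / real N) * (\<Sum>k=1..N. ennreal (\<bar>X k \<omega>\<bar> powr p)) \<partial>M)"
    proof (rule nn_integral_mono)
      fix \<omega>
      have "\<bar>(\<Sum>k=1..N. X k \<omega>) / real N\<bar> powr p \<le> 1 / real N * (\<Sum>k=1..N. \<bar>X k \<omega>\<bar> powr p)"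
        using abs_mean_powr_le[OF \<open>1 \<le> p\<close>, of "{1..N}" "\<lambda>k. X k \<omega>"] that by simp
      then show "ennreal (\<bar>(\<Sum>k=1..N. X k \<omega>) / real N\<bar> powr p)
          \<le> ennreal (1 / real N) * (\<Sum>k=1..N. ennreal (\<bar>X k \<omega>\<bar> powr p))"
        by (subst sum_ennreal, simp, subst ennreal_mult[symmetric])
          (auto intro!: ennreal_leI sum_nonneg)
    qed
    also have "\<dots> = ennreal (1 / real N) * (\<Sum>k=1..N. a k)"
      unfolding a_def using meas
      by (subst nn_integral_cmult, measurable, subst nn_integral_sum) auto
    also have "(\<Sum>k=1..N. a k) = (\<Sum>n<N. a (n + 1))"
      by (rule sum.reindex_bij_witness[of _ "\<lambda>n. n + 1" "\<lambda>k. k - 1"]) auto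
    also have "\<dots> \<le> A"
      unfolding A_def by (rule sum_le_suminf) auto
    finally show ?thesis
      by (simp add: mult_left_mono)
  qed
  have "(\<Sum>n. ennreal (1 / ln (real (n + 2)) powr (1 + \<epsilon>)) *
       (\<integral>\<^sup>+\<omega>. ennreal (\<bar>(\<Sum>k=1..n + 2. X k \<omega>) / real (n + 2)\<bar> powr p) \<partial>M))
      \<le> (\<Sum>n. ennreal (b n) * A)"
  proof (intro suminf_le summableI)
    fix n
    \<comment> \<open>The factor \<open>1 / N\<close> from \<open>mean\<close>, at
      \<open>N = n + 2\<close>, is what turns the logarithmic weight into a Bertrand term.\<close>
    have "ennreal (b n) = ennreal (1 / ln (real (n + 2)) powr (1 + \<epsilon>)) * ennreal (1 / real (n + 2))"
      unfolding b_def by (subst ennreal_mult[symmetric]) (auto simp: mult.commute)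
    then show "ennreal (1 / ln (real (n + 2)) powr (1 + \<epsilon>)) *
       (\<integral>\<^sup>+\<omega>. ennreal (\<bar>(\<Sum>k=1..n + 2. X k \<omega>) / real (n + 2)\<bar> powr p) \<partial>M) \<le> ennreal (b n) * A"
      using mult_left_mono[OF mean[of "n + 2"]] by (simp add: mult.assoc)
  qed
  also have "\<dots> = (\<Sum>n. ennreal (b n)) * A"
    by simp
  also have "\<dots> < \<infinity>"
  proof -
    \<comment> \<open>Here \<open>\<epsilon> > 0\<close> makes the exponent of the logarithm exceed
      1.\<close>
    have "summable b"
      unfolding b_def using \<open>\<epsilon> > 0\<close> by (intro summable_bertrand) simp
    then have "(\<Sum>n. ennreal (b n)) \<noteq> top"
      by (rule ennreal_suminf_neq_top) (simp add: b_def)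
    moreover have "A < \<infinity>"
      using assms(4) by (simp add: A_def a_def)
    ultimately show ?thesis
      by (simp add: ennreal_mult_less_top top.not_eq_extremum)
  qed
  finally show "(\<Sum>n. ennreal (1 / ln (real (n + 2)) powr (1 + \<epsilon>)) *
       (\<integral>\<^sup>+\<omega>. ennreal (\<bar>(\<Sum>k=1..n + 2. X k \<omega>) / real (n + 2)\<bar> powr p) \<partial>M)) < \<infinity>" .
qed

end
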